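(* Let $\chi \in L^1(\mathbb{R})$ be a differentiable function such that $\chi' \in L^1(\mathbb{R})$ and $\lim_{t\to-\infty}\chi(t) = 0$. For $\Omega \in \mathbb{R}$ and $t\in\mathbb{R}$ define $$f_{\Omega}(t) = \int_{-\infty}^{t} \chi(\xi)\, e^{-\mathrm{i}\Omega \xi}\, d\xi .$$ Then, for every $t \in \mathbb{R}$, $$\lim_{\Omega\to\infty} \left( \Omega f_{\Omega}(t) - \mathrm{i}\,\chi(t)\, e^{-\mathrm{i}\Omega t} \right) = 0 .$$
   Context: Here $\mathrm{i}$ is the imaginary unit, $L^1(\mathbb{R})$ is the space of (complex-valued) Lebesgue integrable functions on $\mathbb{R}$, and "differentiable" means differentiable at every point of $\mathbb{R}$, with derivative $\chi'$. The limit $\Omega \to \infty$ is taken over real $\Omega \to +\infty$, with $t$ held fixed. *)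

theory Defs
  imports "HOL-Analysis.Analysis"
begin

definition half_line_fourier :: "(real \<Rightarrow> complex) \<Rightarrow> real \<Rightarrow> real \<Rightarrow> complex" where
  "half_line_fourier X \<Omega> t =
     (LINT \<xi>:{..t}|lebesgue. X \<xi> * exp (- (\<i> * complex_of_real \<Omega> * complex_of_real \<xi>)))"

end

theory Submission imports Defs begin

text \<open>
  Integrating the derivative of $\chi(\xi) e^{-\mathrm{i}\Omega\xi}$ over $(-\infty, t]$ gives
  $\chi(t) e^{-\mathrm{i}\Omega t} = \int_{-\infty}^t \chi' e^{-\mathrm{i}\Omega\xi} d\xi
    - \mathrm{i}\Omega f_\Omega(t)$, so the quantity in question equals
  $-\mathrm{i}\int_{-\infty}^t \chi' e^{-\mathrm{i}\Omega\xi} d\xi$, which tends to $0$ by the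
  Riemann-Lebesgue lemma. As $\chi'$ need not be continuous, the fundamental theorem of calculus
  is used for the Henstock-Kurzweil integral. In the Riemann-Lebesgue lemma, intervals are treated
  by direct integration; a Dynkin system argument extends this to bounded Borel sets, and dominated
  convergence to all integrable functions.
\<close>

section \<open>The Riemann-Lebesgue lemma\<close>

definition fourier_kernel :: "real \<Rightarrow> real \<Rightarrow> complex" where
  "fourier_kernel \<Omega> x = exp (- (\<i> * complex_of_real \<Omega> * complex_of_real x))"

text \<open>Integrability is bundled with the decay because the Bochner integral of a non-integrable
  function is 0 by convention; splitting the integral of a sum needs both summands
  integrable.\<close>

definition fourier_vanishing :: "(real \<Rightarrow> complex) \<Rightarrow> bool" where
  "fourier_vanishing g \<longleftrightarrow> integrable lebesgue g \<and>
     ((\<lambda>\<Omega>. LINT x|lebesgue. g x * fourier_kernel \<Omega> x) \<longlongrightarrow> 0) at_top"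

lemma norm_fourier_kernel [simp]: "norm (fourier_kernel \<Omega> x) = 1"
  by (simp add: fourier_kernel_def norm_exp_eq_Re)

lemma continuous_on_fourier_kernel [continuous_intros]: "continuous_on S (fourier_kernel \<Omega>)"
  unfolding fourier_kernel_def by (intro continuous_intros)

lemma borel_measurable_fourier_kernel [measurable]: "fourier_kernel \<Omega> \<in> borel_measurable borel"
  by (intro borel_measurable_continuous_onI continuous_intros)

lemma lebesgue_measurable_fourier_kernel [measurable]:
  "fourier_kernel \<Omega> \<in> borel_measurable lebesgue"
  by (intro measurable_completion) simp

text \<open>The kernel is the restriction to the real axis of an entire function, whose complex
  derivative is read off along that axis.\<close>

lemma has_vector_derivative_fourier_kernel:
  "(fourier_kernel \<Omega> has_vector_derivative - (\<i> * \<Omega>) * fourier_kernel \<Omega> x) (at x within S)"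
proof -
  have "((\<lambda>z. exp (- (\<i> * of_real \<Omega> * z))) has_field_derivative
      - (\<i> * \<Omega>) * exp (- (\<i> * of_real \<Omega> * of_real x))) (at (of_real x))"
    by (rule derivative_eq_intros refl)+ simp
  from has_vector_derivative_real_field[OF this] show ?thesis
    by (simp add: fourier_kernel_def[abs_def])
qed

lemma integrable_mult_fourier_kernel:
  assumes "integrable lebesgue g"
  shows "integrable lebesgue (\<lambda>x. g x * fourier_kernel \<Omega> x)"
  using assms
  by (rule Bochner_Integration.integrable_bound) (use assms in \<open>auto simp: norm_mult\<close>)

lemma norm_integral_mult_fourier_kernel_le:
  "norm (LINT x|lebesgue. g x * fourier_kernel \<Omega> x) \<le> (LINT x|lebesgue. norm (g x))"
  using integral_norm_bound[of lebesgue "\<lambda>x. g x * fourier_kernel \<Omega> x"] by (simp add: norm_mult)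

section \<open>Closure properties of the class \<open>fourier_vanishing\<close>\<close>

lemma fourier_vanishing_add:
  assumes "fourier_vanishing f" "fourier_vanishing g"
  shows "fourier_vanishing (\<lambda>x. f x + g x)"
proof -
  have "(LINT x|lebesgue. (f x + g x) * fourier_kernel \<Omega> x) =
      (LINT x|lebesgue. f x * fourier_kernel \<Omega> x) + (LINT x|lebesgue. g x * fourier_kernel \<Omega> x)" for \<Omega>
    using assms by (simp add: fourier_vanishing_def distrib_right integrable_mult_fourier_kernel)
  then show ?thesis
    using assms tendsto_add_zero by (force simp: fourier_vanishing_def)
qed

lemma fourier_vanishing_cmult:
  assumes "fourier_vanishing f"
  shows "fourier_vanishing (\<lambda>x. c * f x)"
proof -
  have "(LINT x|lebesgue. (c * f x) * fourier_kernel \<Omega> x) =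
      c * (LINT x|lebesgue. f x * fourier_kernel \<Omega> x)" for \<Omega>
    by (simp add: mult.assoc)
  then show ?thesis
    using assms tendsto_mult_right_zero by (auto simp: fourier_vanishing_def)
qed

lemma fourier_vanishing_zero: "fourier_vanishing (\<lambda>x. 0)"
  by (simp add: fourier_vanishing_def)

lemma fourier_vanishing_sum:
  assumes "\<And>i. i \<in> I \<Longrightarrow> fourier_vanishing (f i)"
  shows "fourier_vanishing (\<lambda>x. \<Sum>i\<in>I. f i x)"
  using assms
proof (induction I rule: infinite_finite_induct)
  case (insert i I)
  then have "fourier_vanishing (\<lambda>x. f i x + (\<Sum>i\<in>I. f i x))"
    by (intro fourier_vanishing_add) simp_all
  then show ?case
    using insert by simp
qed (simp_all add: fourier_vanishing_zero)

text \<open>Domination turns pointwise convergence into convergence in the L1 norm. Since the kernel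
  has modulus 1, the transforms of \<open>f\<close> and \<open>s n\<close> then differ by at most
  the L1 distance, uniformly in \<Omega>, so one \<open>n\<close> can be fixed before \<Omega>
  grows. All the limit passages below go through this lemma.\<close>

lemma fourier_vanishing_dominated_limit:
  assumes s: "\<And>n. fourier_vanishing (s n)"
    and f: "f \<in> borel_measurable lebesgue"
    and lim: "\<And>x. (\<lambda>n. s n x) \<longlonglongrightarrow> f x"
    and bound: "\<And>n x. norm (s n x) \<le> w x"
    and w: "integrable lebesgue w"
  shows "fourier_vanishing f"
proof -
  have s_int: "integrable lebesgue (s n)" for n
    using s by (simp add: fourier_vanishing_def)
  then have s_meas: "s n \<in> borel_measurable lebesgue" for n
    by (rule borel_measurable_integrable)
  have f_bound: "norm (f x) \<le> w x" for x
    by (rule tendsto_upperbound[OF tendsto_norm[OF lim]]) (auto simp: bound)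
  have f_int: "integrable lebesgue f"
    using w f by (rule Bochner_Integration.integrable_bound) (use f_bound in \<open>auto intro!: AE_I2 intro: order_trans[OF _ abs_ge_self]\<close>)
  \<comment> \<open>The limit 0 is written as an integral to match the conclusion of
    \<open>integral_dominated_convergence\<close>. The dominating function is \<open>2 * w\<close>,
    because both \<open>f\<close> and \<open>s n\<close> are bounded by \<open>w\<close>.\<close>
  have L1: "(\<lambda>n. LINT x|lebesgue. norm (f x - s n x)) \<longlonglongrightarrow> (LINT x|(lebesgue :: real measure). 0 :: real)"
  proof (rule integral_dominated_convergence)
    show "integrable lebesgue (\<lambda>x. 2 * w x)"
      using w by simp
    show "AE x in lebesgue. (\<lambda>n. norm (f x - s n x)) \<longlonglongrightarrow> 0"
      using lim by (auto intro!: AE_I2 tendsto_eq_intros)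
    show "AE x in lebesgue. norm (norm (f x - s n x)) \<le> 2 * w x" for n
      using norm_triangle_ineq4[of "f _" "s n _"] f_bound bound[of n]
      by (auto intro!: AE_I2) (smt (verit, best))
  qed (use f s_meas in auto)
  have "((\<lambda>\<Omega>. LINT x|lebesgue. f x * fourier_kernel \<Omega> x) \<longlongrightarrow> 0) at_top"
  proof (rule tendstoI)
    fix e :: real assume "e > 0"
    then have "\<forall>\<^sub>F n in sequentially. (LINT x|lebesgue. norm (f x - s n x)) < e / 2"
      using L1 by (intro order_tendstoD(2)) auto
    then obtain n where n: "(LINT x|lebesgue. norm (f x - s n x)) < e / 2"
      by (auto simp: eventually_sequentially)
    have "\<forall>\<^sub>F \<Omega> in at_top. norm (LINT x|lebesgue. s n x * fourier_kernel \<Omega> x) < e / 2"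
      using s[of n] \<open>e > 0\<close> tendstoD[of _ 0 at_top "e / 2"] by (force simp: fourier_vanishing_def)
    then show "\<forall>\<^sub>F \<Omega> in at_top. dist (LINT x|lebesgue. f x * fourier_kernel \<Omega> x) 0 < e"
    proof eventually_elim
      case (elim \<Omega>)
      have "(LINT x|lebesgue. f x * fourier_kernel \<Omega> x) =
          (LINT x|lebesgue. (f x - s n x) * fourier_kernel \<Omega> x) +
          (LINT x|lebesgue. s n x * fourier_kernel \<Omega> x)"
        using f_int s_int
        by (simp add: integrable_mult_fourier_kernel left_diff_distrib)
      moreover have "norm (LINT x|lebesgue. (f x - s n x) * fourier_kernel \<Omega> x) < e / 2"
        using norm_integral_mult_fourier_kernel_le[of "\<lambda>x. f x - s n x" \<Omega>] f_int s_int n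
        by fastforce
      ultimately show ?case
        using elim norm_triangle_ineq[of "LINT x|lebesgue. (f x - s n x) * fourier_kernel \<Omega> x"
            "LINT x|lebesgue. s n x * fourier_kernel \<Omega> x"]
        by auto
    qed
  qed
  then show ?thesis
    using f_int by (simp add: fourier_vanishing_def)
qed

text \<open>Serves to pass from a Borel set to a Lebesgue measurable set that differs from it by a
  null set.\<close>

lemma fourier_vanishing_cong_AE:
  assumes "fourier_vanishing f" and "AE x in lebesgue. f x = g x"
    and "g \<in> borel_measurable lebesgue"
  shows "fourier_vanishing g"
proof -
  have f: "f \<in> borel_measurable lebesgue"
    using assms(1) by (auto simp: fourier_vanishing_def)
  have "integrable lebesgue g"
    using assms f integrable_cong_AE[of f lebesgue g] by (auto simp: fourier_vanishing_def)
  moreover have "(LINT x|lebesgue. f x * fourier_kernel \<Omega> x) =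
      (LINT x|lebesgue. g x * fourier_kernel \<Omega> x)" for \<Omega>
    using assms f by (intro integral_cong_AE) auto
  ultimately show ?thesis
    using assms(1) by (simp add: fourier_vanishing_def)
qed

section \<open>From intervals to measurable sets of finite measure and to all integrable
  functions\<close>

lemma integrable_indicator_bounded:
  assumes "A \<in> sets lebesgue" "bounded A"
  shows "integrable lebesgue (indicator A :: real \<Rightarrow> complex)"
proof -
  have "integrable lebesgue (\<lambda>x. complex_of_real (indicator A x))"
    using bounded_set_imp_lmeasurable[OF assms(2,1)]
    by (intro integrable_of_real integrable_real_indicator) (auto simp: fmeasurable_def)
  moreover have "(\<lambda>x. complex_of_real (indicator A x)) = indicator A"
    by (auto simp: indicator_def)
  ultimately show ?thesis
    by simp
qed

text \<open>For \<Omega> > 0 the kernel has the antiderivative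
  \<open>(\<i> / \<Omega>) * fourier_kernel \<Omega> x\<close>, so its integral over any interval is
  at most 2 / \<Omega> in modulus.\<close>

lemma fourier_vanishing_indicator_Icc:
  fixes a b :: real
  shows "fourier_vanishing (indicator {a..b})"
proof (cases "a \<le> b")
  case False
  then have "indicator {a..b} = (\<lambda>x. 0 :: complex)"
    by auto
  then show ?thesis
    by (simp add: fourier_vanishing_zero)
next
  case True
  have int: "(LINT x|lebesgue. indicator {a..b} x * fourier_kernel \<Omega> x) =
      (\<i> / \<Omega>) * (fourier_kernel \<Omega> b - fourier_kernel \<Omega> a)" if "\<Omega> > 0" for \<Omega>
  proof -
    have "(LINT x|lborel. indicator {a..b} x *\<^sub>R fourier_kernel \<Omega> x) =
        (\<i> / \<Omega>) * fourier_kernel \<Omega> b - (\<i> / \<Omega>) * fourier_kernel \<Omega> a"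
    proof (rule integral_FTC_atLeastAtMost[OF True])
      show "((\<lambda>x. (\<i> / \<Omega>) * fourier_kernel \<Omega> x) has_vector_derivative fourier_kernel \<Omega> x)
          (at x within {a..b})" for x
        using that
        by (auto intro!: derivative_eq_intros has_vector_derivative_fourier_kernel)
    qed (intro continuous_intros)
    \<comment> \<open>The integrand is Borel measurable, so completing \<open>lborel\<close> does
      not change its integral.\<close>
    moreover have "(LINT x|lebesgue. indicator {a..b} x * fourier_kernel \<Omega> x) =
        (LINT x|lborel. indicator {a..b} x *\<^sub>R fourier_kernel \<Omega> x)"
      by (subst integral_completion)
        (auto intro!: Bochner_Integration.integral_cong simp: indicator_def)
    ultimately show ?thesis
      by (simp add: right_diff_distrib)
  qed
  have "((\<lambda>\<Omega>. LINT x|lebesgue. indicator {a..b} x * fourier_kernel \<Omega> x) \<longlongrightarrow> 0) at_top"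
  proof (rule Lim_null_comparison)
    show "((\<lambda>\<Omega>::real. 2 / \<Omega>) \<longlongrightarrow> 0) at_top"
      by (intro tendsto_divide_0[OF tendsto_const] filterlim_at_top_imp_at_infinity filterlim_ident)
    show "\<forall>\<^sub>F \<Omega> in at_top. norm (LINT x|lebesgue. indicator {a..b} x * fourier_kernel \<Omega> x) \<le> 2 / \<Omega>"
      using eventually_gt_at_top[of 0]
    proof eventually_elim
      case (elim \<Omega>)
      have "norm (fourier_kernel \<Omega> b - fourier_kernel \<Omega> a) \<le> 2"
        using norm_triangle_ineq4[of "fourier_kernel \<Omega> b" "fourier_kernel \<Omega> a"] by simp
      then show ?case
        using elim by (simp add: int norm_mult norm_divide divide_right_mono)
    qed
  qed
  then show ?thesis
    by (simp add: fourier_vanishing_def integrable_indicator_bounded)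
qed

text \<open>The rays \<open>{..a}\<close> generate the Borel sets and are closed under intersection,
  so complements and disjoint countable unions suffice. Truncating to \<open>{-r..r}\<close> makes
  rays into intervals and keeps complements integrable.\<close>

lemma fourier_vanishing_indicator_bounded_Borel:
  fixes A :: "real set"
  assumes "A \<in> sets borel"
  shows "fourier_vanishing (indicator (A \<inter> {-r..r}))"
proof -
  have stable: "Int_stable (range (\<lambda>a::real. {..a}))"
    by (auto simp: Int_stable_def)
  have subset_Pow: "range (\<lambda>a::real. {..a}) \<subseteq> Pow UNIV"
    by simp
  have "A \<in> sigma_sets UNIV (range (\<lambda>a::real. {..a}))"
    using assms by (simp add: borel_eq_atMost)
  with stable subset_Pow show ?thesis
  proof (induction rule: sigma_sets_induct_disjoint)
    case (basic A)
    then obtain a where "A = {..a}"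
      by auto
    then have "A \<inter> {-r..r} = {-r..min a r}"
      by auto
    then show ?case
      by (simp add: fourier_vanishing_indicator_Icc)
  next
    case empty
    show ?case
      by (simp add: fourier_vanishing_zero)
  next
    case (compl A)
    have "indicator ((UNIV - A) \<inter> {-r..r}) =
        (\<lambda>x. indicator {-r..r} x + (-1) * indicator (A \<inter> {-r..r}) x :: complex)"
      by (auto simp: indicator_def)
    then show ?case
      using compl fourier_vanishing_cmult fourier_vanishing_add fourier_vanishing_indicator_Icc
      by presburger
  next
    case (union A)
    have A: "A i \<in> sets borel" for i
      using union by (auto simp: borel_eq_atMost)
    \<comment> \<open>Disjointness makes the indicator of a finite union a finite sum; the countable
      union is then a limit dominated by the indicator of \<open>{-r..r}\<close>.\<close>
    have part: "indicator ((\<Union>i<n. A i) \<inter> {-r..r}) =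
        (\<lambda>x. \<Sum>i<n. indicator (A i \<inter> {-r..r}) x :: complex)" for n
    proof
      fix x
      have "disjoint_family_on (\<lambda>i. A i \<inter> {-r..r}) {..<n}"
        using union(1) by (auto simp: disjoint_family_on_def)
      from indicator_UN_disjoint[OF _ this, of x]
      show "indicator ((\<Union>i<n. A i) \<inter> {-r..r}) x =
          (\<Sum>i<n. indicator (A i \<inter> {-r..r}) x :: complex)"
        by simp
    qed
    show ?case
    proof (rule fourier_vanishing_dominated_limit)
      show "fourier_vanishing (indicator ((\<Union>i<n. A i) \<inter> {-r..r}))" for n
        unfolding part using union by (intro fourier_vanishing_sum) auto
      show "(\<lambda>n. indicator ((\<Union>i<n. A i) \<inter> {-r..r}) x)
          \<longlonglongrightarrow> (indicator (\<Union> (range A) \<inter> {-r..r}) x :: complex)" for x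
        using LIMSEQ_indicator_UN[of "\<lambda>i. A i \<inter> {-r..r}" x] by simp
      show "integrable lebesgue (indicator {-r..r} :: real \<Rightarrow> real)"
        by (intro integrable_real_indicator) (auto simp: emeasure_lborel_Icc_eq)
      show "indicator (\<Union> (range A) \<inter> {-r..r}) \<in> borel_measurable lebesgue"
        using A by (intro measurable_completion borel_measurable_indicator) auto
    qed (simp add: indicator_def)
  qed
qed

lemma fourier_vanishing_indicator:
  assumes A: "A \<in> sets lebesgue" and fin: "emeasure lebesgue A < \<infinity>"
  shows "fourier_vanishing (indicator A)"
proof -
  \<comment> \<open>\<open>S\<close> is the Borel part of \<open>A\<close>, reached as the limit of
    its bounded truncations. They all lie in \<open>A\<close>, whose finite measure makes its
    indicator an integrable bound.\<close>
  obtain S N N' where S: "A = S \<union> N" "N \<subseteq> N'" "N' \<in> null_sets lborel" "S \<in> sets lborel"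
    using A by (rule sets_completionE)
  then have S_sets: "S \<in> sets lebesgue"
    by auto
  have "fourier_vanishing (indicator S)"
  proof (rule fourier_vanishing_dominated_limit)
    show "fourier_vanishing (indicator (S \<inter> {- real n..real n}))" for n
      using S by (intro fourier_vanishing_indicator_bounded_Borel) simp
    show "(\<lambda>n. indicator (S \<inter> {- real n..real n}) x) \<longlonglongrightarrow> (indicator S x :: complex)" for x
    proof (rule tendsto_eventually)
      obtain n where "\<bar>x\<bar> \<le> real n"
        using real_arch_simple by blast
      then show "\<forall>\<^sub>F n in sequentially.
          indicator (S \<inter> {- real n..real n}) x = (indicator S x :: complex)"
        by (intro eventually_sequentiallyI[of n]) (auto simp: indicator_def)
    qed
    show "integrable lebesgue (indicator A :: real \<Rightarrow> real)"
      using A fin by simp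
    show "indicator S \<in> borel_measurable lebesgue"
      using S_sets by (rule borel_measurable_indicator)
  qed (use S in \<open>auto simp: indicator_def\<close>)
  moreover have "AE x in lebesgue. indicator S x = (indicator A x :: complex)"
    using AE_completion[OF AE_not_in[OF S(3)]]
    by eventually_elim (use S(1,2) in \<open>auto simp: indicator_def\<close>)
  ultimately show ?thesis
    by (rule fourier_vanishing_cong_AE[OF _ _ borel_measurable_indicator[OF A]])
qed

theorem riemann_lebesgue:
  assumes "integrable lebesgue g"
  shows "fourier_vanishing g"
  using assms
proof (induction rule: integrable_induct)
  case (base A c)
  have "(\<lambda>x. indicator A x *\<^sub>R c) = (\<lambda>x. c * indicator A x)"
    by (auto simp: indicator_def)
  then show ?case
    using base by (simp add: fourier_vanishing_cmult fourier_vanishing_indicator)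
next
  case (add f g)
  then show ?case
    by (simp add: fourier_vanishing_add)
next
  case (lim f s)
  show ?case
  proof (rule fourier_vanishing_dominated_limit)
    show "fourier_vanishing (s n)" for n
      by fact
    \<comment> \<open>The factor 2 is the bound that \<open>integrable_induct\<close> provides for
      its approximating sequence.\<close>
    show "f \<in> borel_measurable lebesgue" "integrable lebesgue (\<lambda>x. 2 * norm (f x))"
      using \<open>integrable lebesgue f\<close> by simp_all
    show "(\<lambda>n. s n x) \<longlonglongrightarrow> f x" "norm (s n x) \<le> 2 * norm (f x)" for n x
      by (simp_all add: lim)
  qed
qed

section \<open>Integration by parts on the half-line\<close>

text \<open>Apply the fundamental theorem on \<open>{a..t}\<close> and let a tend to minus infinity:
  the integrals converge by integrability of \<open>F'\<close>, the boundary term \<open>F a\<close>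
  vanishes by \<open>lim\<close>.\<close>

lemma set_integral_vector_derivative_atMost:
  fixes F :: "real \<Rightarrow> 'a::euclidean_space"
  assumes F: "\<And>x. x \<le> t \<Longrightarrow> (F has_vector_derivative F' x) (at x)"
    and int: "set_integrable lebesgue {..t} F'"
    and lim: "(F \<longlongrightarrow> 0) at_bot"
  shows "(LINT x:{..t}|lebesgue. F' x) = F t"
proof (rule tendsto_unique)
  show "((\<lambda>a. LINT x:{a..t}|lebesgue. F' x) \<longlongrightarrow> (LINT x:{..t}|lebesgue. F' x)) at_bot"
    by (rule tendsto_set_lebesgue_integral_at_bot[OF _ int]) auto
  have "(LINT x:{a..t}|lebesgue. F' x) = F t - F a" if "a \<le> t" for a
  proof -
    have "set_integrable lebesgue {a..t} F'"
      using int by (rule set_integrable_subset) auto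
    \<comment> \<open>The gauge integral recovers \<open>F\<close> from any derivative, continuous
      or not; integrability of \<open>F'\<close> identifies it with the Lebesgue integral.\<close>
    then have "(LINT x:{a..t}|lebesgue. F' x) = integral {a..t} F'"
      by (rule set_lebesgue_integral_eq_integral)
    also have "\<dots> = F t - F a"
      using that F
      by (intro integral_unique fundamental_theorem_of_calculus)
        (auto intro: has_vector_derivative_at_within)
    finally show ?thesis .
  qed
  then have "\<forall>\<^sub>F a in at_bot. F t - F a = (LINT x:{a..t}|lebesgue. F' x)"
    by (intro eventually_mono[OF eventually_le_at_bot[of t]]) simp
  moreover have "((\<lambda>a. F t - F a) \<longlongrightarrow> F t) at_bot"
    using lim by (auto intro!: tendsto_eq_intros)
  ultimately show "((\<lambda>a. LINT x:{a..t}|lebesgue. F' x) \<longlongrightarrow> F t) at_bot"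
    by (rule Lim_transform_eventually[rotated])
qed simp

lemma half_line_fourier_by_parts:
  fixes X :: "real \<Rightarrow> complex"
  assumes X: "integrable lebesgue X"
    and diff: "\<And>t. X differentiable (at t)"
    and X': "integrable lebesgue (\<lambda>t. vector_derivative X (at t))"
    and lim: "(X \<longlongrightarrow> 0) at_bot"
  shows "complex_of_real \<Omega> * half_line_fourier X \<Omega> t - \<i> * X t * fourier_kernel \<Omega> t =
    - \<i> * (LINT x:{..t}|lebesgue. vector_derivative X (at x) * fourier_kernel \<Omega> x)"
proof -
  let ?X' = "\<lambda>x. vector_derivative X (at x)"
  have int: "set_integrable lebesgue {..t} (\<lambda>x. g x * fourier_kernel \<Omega> x)"
    if "integrable lebesgue g" for g
    using integrable_mult_indicator[OF _ integrable_mult_fourier_kernel[OF that]]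
    by (simp add: set_integrable_def)
  have "(LINT x:{..t}|lebesgue.
      ?X' x * fourier_kernel \<Omega> x - \<i> * \<Omega> * (X x * fourier_kernel \<Omega> x)) = X t * fourier_kernel \<Omega> t"
  proof (rule set_integral_vector_derivative_atMost)
    show "((\<lambda>x. X x * fourier_kernel \<Omega> x) has_vector_derivative
        ?X' x * fourier_kernel \<Omega> x - \<i> * \<Omega> * (X x * fourier_kernel \<Omega> x)) (at x)" for x
      using has_vector_derivative_mult[OF diff[of x, unfolded vector_derivative_works]
          has_vector_derivative_fourier_kernel[of \<Omega> x]]
      by (simp add: algebra_simps)
    \<comment> \<open>The kernel has modulus 1, so the product decays exactly as \<open>X\<close>
      does.\<close>
    show "((\<lambda>x. X x * fourier_kernel \<Omega> x) \<longlongrightarrow> 0) at_bot"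
      by (rule Lim_null_comparison[OF _ tendsto_norm_zero[OF lim]]) (simp add: norm_mult)
  qed (intro set_integral_diff set_integrable_mult_right int X X')
  moreover have "(LINT x:{..t}|lebesgue.
      ?X' x * fourier_kernel \<Omega> x - \<i> * \<Omega> * (X x * fourier_kernel \<Omega> x)) =
      (LINT x:{..t}|lebesgue. ?X' x * fourier_kernel \<Omega> x) - \<i> * \<Omega> * half_line_fourier X \<Omega> t"
    unfolding half_line_fourier_def fourier_kernel_def[symmetric]
    by (simp add: set_integral_diff int X X' set_integrable_mult_right)
  ultimately have "(LINT x:{..t}|lebesgue. ?X' x * fourier_kernel \<Omega> x) =
      X t * fourier_kernel \<Omega> t + \<i> * (\<Omega> * half_line_fourier X \<Omega> t)"
    by (simp add: diff_eq_eq mult.assoc)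
  \<comment> \<open>Multiplying the previous equation by \<open>- \<i>\<close> isolates the term
    with \<Omega>, as \<open>- \<i> * \<i> = 1\<close>.\<close>
  then show ?thesis
    by (simp add: distrib_left mult.assoc)
qed

theorem theorem1:
  fixes X :: "real \<Rightarrow> complex"
  assumes "integrable lebesgue X"
    and "\<And>t. X differentiable (at t)"
    and "integrable lebesgue (\<lambda>t. vector_derivative X (at t))"
    and "(X \<longlongrightarrow> 0) at_bot"
  shows "\<forall>t. ((\<lambda>\<Omega>. complex_of_real \<Omega> * half_line_fourier X \<Omega> t
                - \<i> * X t * exp (- (\<i> * complex_of_real \<Omega> * complex_of_real t)))
           \<longlongrightarrow> 0) at_top"
proof
  fix t
  \<comment> \<open>Cutting the derivative off at the fixed \<open>t\<close> turns the half-line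
    integral into one over the whole line, where \<open>riemann_lebesgue\<close> applies.\<close>
  let ?g = "\<lambda>x. indicator {..t} x *\<^sub>R vector_derivative X (at x)"
  have "fourier_vanishing ?g"
    using assms(3) by (intro riemann_lebesgue integrable_mult_indicator) auto
  then have "((\<lambda>\<Omega>. LINT x:{..t}|lebesgue. vector_derivative X (at x) * fourier_kernel \<Omega> x)
      \<longlongrightarrow> 0) at_top"
    by (simp add: fourier_vanishing_def set_lebesgue_integral_def)
  from tendsto_mult_right_zero[OF this, of "- \<i>"]
  show "((\<lambda>\<Omega>. complex_of_real \<Omega> * half_line_fourier X \<Omega> t
                - \<i> * X t * exp (- (\<i> * complex_of_real \<Omega> * complex_of_real t)))
           \<longlongrightarrow> 0) at_top"
    unfolding fourier_kernel_def[of _ t, symmetric]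
    by (simp only: half_line_fourier_by_parts[OF assms])
qed

end
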